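(* Let $a_1,a_2,a_3$ be distinct non-null points such that the lines $a_1a_2$ and $a_1a_3$ are non-null. Let $q_2\equiv q(a_1,a_3)$ and $q_3\equiv q(a_1,a_2)$ be quadrances, $S_1\equiv S(a_1a_2,a_1a_3)$ the spread, and $\mathcal A\equiv\mathcal A(a_1,a_2,a_3)$ the quadrea. Then $$q_2q_3S_1=\mathcal A.$$
   Context: Let $\mathbb F$ be a field of characteristic not two. A 3-proportion $x:y:z$ is a triple of elements of $\mathbb F$, not all zero, up to a common non-zero scalar. A point $a=[x:y:z]$ and a line $L=(l:m:n)$ are both 3-proportions. The point $[x:y:z]$ lies on the line $(l:m:n)$ when $lx+my-nz=0$. For distinct points $a,b$, the join $ab$ is the unique line through both. A point $[x:y:z]$ is null when $x^2+y^2-z^2=0$; a line $(l:m:n)$ is null when $l^2+m^2-n^2=0$. The quadrance between non-null points $a_1=[x_1:y_1:z_1]$, $a_2=[x_2:y_2:z_2]$ is $$q(a_1,a_2)=1-\frac{(x_1x_2+y_1y_2-z_1z_2)^2}{(x_1^2+y_1^2-z_1^2)(x_2^2+y_2^2-z_2^2)}.$$ The spread between non-null lines $L_1=(l_1:m_1:n_1)$, $L_2=(l_2:m_2:n_2)$ is $$S(L_1,L_2)=1-\frac{(l_1l_2+m_1m_2-n_1n_2)^2}{(l_1^2+m_1^2-n_1^2)(l_2^2+m_2^2-n_2^2)}.$$ The quadrea of three non-null points $a_i=[x_i:y_i:z_i]$, $i=1,2,3$, is $$\mathcal A(a_1,a_2,a_3)=-\frac{(x_1y_2z_3-x_1y_3z_2+x_2y_3z_1-x_3y_2z_1+x_3y_1z_2-x_2y_1z_3)^2}{(x_1^2+y_1^2-z_1^2)(x_2^2+y_2^2-z_2^2)(x_3^2+y_3^2-z_3^2)}.$$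 *)

theory Defs
  imports Complex_Main
begin

definition proprel :: "'a::field \<times> 'a \<times> 'a \<Rightarrow> 'a \<times> 'a \<times> 'a \<Rightarrow> bool" where
  "proprel = (\<lambda>(x, y, z) (x', y', z'). (x, y, z) \<noteq> (0, 0, 0) \<and> (x', y', z') \<noteq> (0, 0, 0) \<and>
     (\<exists>c. c \<noteq> 0 \<and> x' = c * x \<and> y' = c * y \<and> z' = c * z))"

lemma proprel_iff:
  "proprel (x, y, z) (x', y', z') \<longleftrightarrow> (x, y, z) \<noteq> (0, 0, 0) \<and> (x', y', z') \<noteq> (0, 0, 0) \<and>
     (\<exists>c. c \<noteq> 0 \<and> x' = c * x \<and> y' = c * y \<and> z' = c * z)"
  by (simp add: proprel_def)

lemma part_equivp_proprel: "part_equivp (proprel :: 'a::field \<times> 'a \<times> 'a \<Rightarrow> _)"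
proof (rule part_equivpI)
  have "proprel (1, 0, 0) (1, 0, 0 :: 'a)"
    unfolding proprel_iff by (auto intro!: exI[of _ 1])
  then show "\<exists>t. proprel t (t :: 'a \<times> 'a \<times> 'a)" by blast
  show "symp (proprel :: 'a \<times> 'a \<times> 'a \<Rightarrow> _)"
  proof (rule sympI, clarify)
    fix x y z x' y' z' :: 'a
    assume "proprel (x, y, z) (x', y', z')"
    then obtain c where "(x, y, z) \<noteq> (0, 0, 0)" "(x', y', z') \<noteq> (0, 0, 0)"
      and "c \<noteq> 0" "x' = c * x" "y' = c * y" "z' = c * z"
      unfolding proprel_iff by blast
    then show "proprel (x', y', z') (x, y, z)"
      unfolding proprel_iff by (auto intro!: exI[of _ "inverse c"] simp: field_simps)
  qed
  show "transp (proprel :: 'a \<times> 'a \<times> 'a \<Rightarrow> _)"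
  proof (rule transpI, clarify)
    fix x y z x' y' z' x'' y'' z'' :: 'a
    assume "proprel (x, y, z) (x', y', z')" "proprel (x', y', z') (x'', y'', z'')"
    then obtain c d where "(x, y, z) \<noteq> (0, 0, 0)" "(x'', y'', z'') \<noteq> (0, 0, 0)"
      and "c \<noteq> 0" "x' = c * x" "y' = c * y" "z' = c * z"
      and "d \<noteq> 0" "x'' = d * x'" "y'' = d * y'" "z'' = d * z'"
      unfolding proprel_iff by blast
    then show "proprel (x, y, z) (x'', y'', z'')"
      unfolding proprel_iff by (auto intro!: exI[of _ "d * c"])
  qed
qed

quotient_type (overloaded) 'a proportion = "'a::field \<times> 'a \<times> 'a" / partial: proprel
  by (rule part_equivp_proprel)

type_synonym 'a point = "'a proportion"
type_synonym 'a line = "'a proportion"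

lemma proprelE:
  assumes "proprel p q"
  obtains c x y z where "p = (x, y, z)" "q = (c * x, c * y, c * z)" "c \<noteq> 0"
  using assms by (cases p; cases q) (auto simp: proprel_iff)

lemma
  fixes c d x y z x1 y1 z1 x2 y2 z2 :: "'a::field"
  shows form_scale: "(c * x)\<^sup>2 + (c * y)\<^sup>2 - (c * z)\<^sup>2 = c\<^sup>2 * (x\<^sup>2 + y\<^sup>2 - z\<^sup>2)"
    and bilinear_scale: "c * x1 * (d * x2) + c * y1 * (d * y2) - c * z1 * (d * z2)
           = c * d * (x1 * x2 + y1 * y2 - z1 * z2)"
  by (simp_all add: algebra_simps power2_eq_square)

lemma cos_sq_scale:
  fixes c d x1 y1 z1 x2 y2 z2 :: "'a::field"
  assumes "c \<noteq> 0" "d \<noteq> 0"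
  shows "(c * x1 * (d * x2) + c * y1 * (d * y2) - c * z1 * (d * z2))\<^sup>2 /
       (((c * x1)\<^sup>2 + (c * y1)\<^sup>2 - (c * z1)\<^sup>2) * ((d * x2)\<^sup>2 + (d * y2)\<^sup>2 - (d * z2)\<^sup>2))
     = (x1 * x2 + y1 * y2 - z1 * z2)\<^sup>2 /
       ((x1\<^sup>2 + y1\<^sup>2 - z1\<^sup>2) * (x2\<^sup>2 + y2\<^sup>2 - z2\<^sup>2))"
proof -
  have "(c * d * B)\<^sup>2 / (c\<^sup>2 * M * (d\<^sup>2 * N)) = B\<^sup>2 / (M * N)" for B M N :: 'a
  proof -
    have "(c * d * B)\<^sup>2 / (c\<^sup>2 * M * (d\<^sup>2 * N)) = (c\<^sup>2 * d\<^sup>2 * B\<^sup>2) / (c\<^sup>2 * d\<^sup>2 * (M * N))"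
      by (simp add: power_mult_distrib mult_ac)
    also have "\<dots> = B\<^sup>2 / (M * N)"
      using assms by (intro mult_divide_mult_cancel_left) simp
    finally show ?thesis .
  qed
  then show ?thesis
    unfolding form_scale bilinear_scale by blast
qed

lemma det_sq_scale:
  fixes c d e x1 y1 z1 x2 y2 z2 x3 y3 z3 :: "'a::field"
  assumes "c \<noteq> 0" "d \<noteq> 0" "e \<noteq> 0"
  shows "(c * x1 * (d * y2) * (e * z3) - c * x1 * (e * y3) * (d * z2)
          + d * x2 * (e * y3) * (c * z1) - e * x3 * (d * y2) * (c * z1)
          + e * x3 * (c * y1) * (d * z2) - d * x2 * (c * y1) * (e * z3))\<^sup>2 /
       (((c * x1)\<^sup>2 + (c * y1)\<^sup>2 - (c * z1)\<^sup>2) * ((d * x2)\<^sup>2 + (d * y2)\<^sup>2 - (d * z2)\<^sup>2)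
        * ((e * x3)\<^sup>2 + (e * y3)\<^sup>2 - (e * z3)\<^sup>2))
     = (x1 * y2 * z3 - x1 * y3 * z2 + x2 * y3 * z1 - x3 * y2 * z1 + x3 * y1 * z2 - x2 * y1 * z3)\<^sup>2 /
       ((x1\<^sup>2 + y1\<^sup>2 - z1\<^sup>2) * (x2\<^sup>2 + y2\<^sup>2 - z2\<^sup>2) * (x3\<^sup>2 + y3\<^sup>2 - z3\<^sup>2))"
proof -
  have cancel: "(c * d * e * D)\<^sup>2 / (c\<^sup>2 * M * (d\<^sup>2 * N) * (e\<^sup>2 * P)) = D\<^sup>2 / (M * N * P)"
    for D M N P :: 'a
  proof -
    have "(c * d * e * D)\<^sup>2 / (c\<^sup>2 * M * (d\<^sup>2 * N) * (e\<^sup>2 * P))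
        = (c\<^sup>2 * d\<^sup>2 * e\<^sup>2 * D\<^sup>2) / (c\<^sup>2 * d\<^sup>2 * e\<^sup>2 * (M * N * P))"
      by (simp add: power_mult_distrib mult_ac)
    also have "\<dots> = D\<^sup>2 / (M * N * P)"
      using assms by (intro mult_divide_mult_cancel_left) simp
    finally show ?thesis .
  qed
  have "c * x1 * (d * y2) * (e * z3) - c * x1 * (e * y3) * (d * z2)
          + d * x2 * (e * y3) * (c * z1) - e * x3 * (d * y2) * (c * z1)
          + e * x3 * (c * y1) * (d * z2) - d * x2 * (c * y1) * (e * z3)
      = c * d * e * (x1 * y2 * z3 - x1 * y3 * z2 + x2 * y3 * z1 - x3 * y2 * z1
          + x3 * y1 * z2 - x2 * y1 * z3)"
    by (simp add: algebra_simps)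
  then show ?thesis
    unfolding form_scale by (simp only: cancel)
qed

lemma incidence_scale:
  fixes c d x y z l m n :: "'a::field"
  assumes "c \<noteq> 0" "d \<noteq> 0"
  shows "d * l * (c * x) + d * m * (c * y) - d * n * (c * z) = 0 \<longleftrightarrow> l * x + m * y - n * z = 0"
  using assms by (simp add: bilinear_scale)

lift_definition lies_on :: "'a::field point \<Rightarrow> 'a line \<Rightarrow> bool"
  is "\<lambda>(x, y, z) (l, m, n). l * x + m * y - n * z = 0"
  by (auto elim!: proprelE simp: incidence_scale simp del: right_minus_eq)

text \<open>For distinct points the line through both is unique; for equal points the value
  of \<^term>\<open>join a b\<close> is unspecified.\<close>

definition join :: "'a::field point \<Rightarrow> 'a point \<Rightarrow> 'a line" where
  "join a b = (THE L. lies_on a L \<and> lies_on b L)"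

lift_definition null_point :: "'a::field point \<Rightarrow> bool"
  is "\<lambda>(x, y, z). x\<^sup>2 + y\<^sup>2 - z\<^sup>2 = 0"
  by (auto elim!: proprelE simp: form_scale simp del: right_minus_eq)

lift_definition null_line :: "'a::field line \<Rightarrow> bool"
  is "\<lambda>(l, m, n). l\<^sup>2 + m\<^sup>2 - n\<^sup>2 = 0"
  by (auto elim!: proprelE simp: form_scale simp del: right_minus_eq)

text \<open>The three quantities below are meaningful only for non-null arguments; at null
  arguments a denominator is zero and the convention \<open>x / 0 = 0\<close> applies.\<close>

lift_definition quadrance :: "'a::field point \<Rightarrow> 'a point \<Rightarrow> 'a"
  is "\<lambda>(x1, y1, z1) (x2, y2, z2).
        1 - (x1 * x2 + y1 * y2 - z1 * z2)\<^sup>2 /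
            ((x1\<^sup>2 + y1\<^sup>2 - z1\<^sup>2) * (x2\<^sup>2 + y2\<^sup>2 - z2\<^sup>2))"
  by (auto elim!: proprelE simp: cos_sq_scale)

lift_definition spread :: "'a::field line \<Rightarrow> 'a line \<Rightarrow> 'a"
  is "\<lambda>(l1, m1, n1) (l2, m2, n2).
        1 - (l1 * l2 + m1 * m2 - n1 * n2)\<^sup>2 /
            ((l1\<^sup>2 + m1\<^sup>2 - n1\<^sup>2) * (l2\<^sup>2 + m2\<^sup>2 - n2\<^sup>2))"
  by (auto elim!: proprelE simp: cos_sq_scale)

lift_definition quadrea :: "'a::field point \<Rightarrow> 'a point \<Rightarrow> 'a point \<Rightarrow> 'a"
  is "\<lambda>(x1, y1, z1) (x2, y2, z2) (x3, y3, z3).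
        - ((x1 * y2 * z3 - x1 * y3 * z2 + x2 * y3 * z1 - x3 * y2 * z1 + x3 * y1 * z2 - x2 * y1 * z3)\<^sup>2 /
           ((x1\<^sup>2 + y1\<^sup>2 - z1\<^sup>2) * (x2\<^sup>2 + y2\<^sup>2 - z2\<^sup>2) * (x3\<^sup>2 + y3\<^sup>2 - z3\<^sup>2)))"
  by (auto elim!: proprelE simp: det_sq_scale)

end

theory Submission
  imports Defs
begin

text \<open>
  Write \<open>Q\<close> for the form \<open>x\<^sup>2 + y\<^sup>2 - z\<^sup>2\<close> and \<open>B\<close> for its bilinear form. The join of \<open>a\<^sub>1\<close> and \<open>a\<^sub>2\<close>
  is their cross product with the sign of the last entry flipped, and the Lagrange identity gives
  \<open>Q(a\<^sub>1a\<^sub>2) = B(a\<^sub>1, a\<^sub>2)\<^sup>2 - Q(a\<^sub>1) Q(a\<^sub>2)\<close>, that is,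
  \<open>q(a\<^sub>1, a\<^sub>2) = - Q(a\<^sub>1a\<^sub>2) / (Q(a\<^sub>1) Q(a\<^sub>2))\<close>. The same identity for the lines \<open>a\<^sub>1a\<^sub>2\<close> and \<open>a\<^sub>1a\<^sub>3\<close>,
  whose cross product is \<open>det(a\<^sub>1, a\<^sub>2, a\<^sub>3)\<close> times \<open>a\<^sub>1\<close>, expresses the spread through \<open>Q(a\<^sub>1)\<close> and
  the determinant; multiplying the three expressions, everything but the quadrea cancels.
\<close>

lemma proprel_refl_iff: "proprel u u \<longleftrightarrow> u \<noteq> (0, 0, 0)"
  by (cases u) (auto simp: proprel_iff intro!: exI[of _ 1])

text \<open>The quotient is partial, so the coordinates come with the reflexivity fact that the
  \<open>abs_eq\<close> rules require; it says that the triple is nonzero.\<close>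

lemma proportion_cases:
  obtains x y z where "p = abs_proportion (x, y, z)" "proprel (x, y, z) (x, y, z)"
proof -
  have "abs_proportion (rep_proportion p) = p" "proprel (rep_proportion p) (rep_proportion p)"
    using Quotient3_abs_rep[OF Quotient3_proportion] Quotient3_rep_reflp[OF Quotient3_proportion]
    by auto
  then show thesis
    by (cases "rep_proportion p") (auto intro: that)
qed

text \<open>Any nonzero coordinate of the first triple fixes the scalar as a ratio, and the cross
  equations carry it to the other two.\<close>

lemma proprel_if_cross_eq:
  fixes x y z x' y' z' :: "'a::field"
  assumes "(x, y, z) \<noteq> (0, 0, 0)" "(x', y', z') \<noteq> (0, 0, 0)"
    and "y * z' = z * y'" "z * x' = x * z'" "x * y' = y * x'"
  shows "proprel (x, y, z) (x', y', z')"
proof -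
  consider "x \<noteq> 0" | "y \<noteq> 0" | "z \<noteq> 0"
    using assms(1) by auto
  then have "\<exists>c. x' = c * x \<and> y' = c * y \<and> z' = c * z"
  proof cases
    case 1
    then show ?thesis
      using assms by (intro exI[of _ "x' / x"]) (simp add: field_simps)
  next
    case 2
    then show ?thesis
      using assms by (intro exI[of _ "y' / y"]) (simp add: field_simps)
  next
    case 3
    then show ?thesis
      using assms by (intro exI[of _ "z' / z"]) (simp add: field_simps)
  qed
  then obtain c where c: "x' = c * x" "y' = c * y" "z' = c * z"
    by blast
  moreover have "c \<noteq> 0"
    using assms(2) c by auto
  ultimately show ?thesis
    using assms(1,2) by (auto simp: proprel_iff)
qed

text \<open>The third entry is negated because incidence reads \<open>lx + my - nz = 0\<close>.\<close>

definition cross :: "'a::field \<times> 'a \<times> 'a \<Rightarrow> 'a \<times> 'a \<times> 'a \<Rightarrow> 'a \<times> 'a \<times> 'a" where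
  "cross = (\<lambda>(x, y, z) (x', y', z'). (y * z' - z * y', z * x' - x * z', y * x' - x * y'))"

text \<open>A zero cross product would make the triples proportional, hence the points
  equal.\<close>

lemma proprel_cross:
  assumes "proprel u u" "proprel v v" "abs_proportion u \<noteq> abs_proportion v"
  shows "proprel (cross u v) (cross u v)"
proof -
  have "\<not> proprel u v"
    using assms(3) Quotient3_rel_abs[OF Quotient3_proportion] by blast
  then show ?thesis
    using assms(1,2) proprel_if_cross_eq
    by (cases u; cases v) (fastforce simp: proprel_refl_iff cross_def)
qed

lemma join_abs_proportion:
  fixes u v :: "'a::field \<times> 'a \<times> 'a"
  assumes "proprel u u" "proprel v v" "abs_proportion u \<noteq> abs_proportion v"
  shows "join (abs_proportion u) (abs_proportion v) = abs_proportion (cross u v)"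
  unfolding join_def
proof (rule the_equality)
  note c = proprel_cross[OF assms]
  obtain x y z x' y' z' where uv: "u = (x, y, z)" "v = (x', y', z')"
    by (cases u; cases v)
  show "lies_on (abs_proportion u) (abs_proportion (cross u v)) \<and>
      lies_on (abs_proportion v) (abs_proportion (cross u v))"
    using assms(1,2) c
    by (simp add: lies_on.abs_eq) (simp add: uv cross_def algebra_simps)
  fix L :: "'a line"
  assume L: "lies_on (abs_proportion u) L \<and> lies_on (abs_proportion v) L"
  obtain l m n where l: "L = abs_proportion (l, m, n)" "proprel (l, m, n) (l, m, n)"
    by (rule proportion_cases)
  have perp: "l * x + m * y - n * z = 0" "l * x' + m * y' - n * z' = 0"
    using L l assms(1,2) by (simp_all add: lies_on.abs_eq uv)
  \<comment> \<open>Eliminating \<open>l\<close>, \<open>m\<close> and \<open>n\<close> in turn from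
    the two incidences shows that \<open>(l, m, n)\<close> is parallel to
    \<open>cross u v\<close>.\<close>
  have "m * (y * x' - x * y') = n * (z * x' - x * z')"
    "n * (y * z' - z * y') = l * (y * x' - x * y')"
    "l * (z * x' - x * z') = m * (y * z' - z * y')"
    using perp by algebra+
  then have "proprel (l, m, n) (cross u v)"
    using c l(2) unfolding proprel_refl_iff
    by (auto simp: uv cross_def intro!: proprel_if_cross_eq)
  then show "L = abs_proportion (cross u v)"
    using Quotient3_rel_abs[OF Quotient3_proportion] l(1) by blast
qed

text \<open>This exposes the numerator that the Lagrange identities evaluate.\<close>

lemma one_minus_sq_divide:
  fixes b p q :: "'a::field"
  assumes "p \<noteq> 0" "q \<noteq> 0"
  shows "1 - b\<^sup>2 / (p * q) = (p * q - b\<^sup>2) / (p * q)"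
  using assms by (simp add: field_simps)

theorem theorem47:
  fixes a1 a2 a3 :: "'a::field point"
  assumes "CHAR('a) \<noteq> 2"
    and "a1 \<noteq> a2" and "a1 \<noteq> a3" and "a2 \<noteq> a3"
    and "\<not> null_point a1" and "\<not> null_point a2" and "\<not> null_point a3"
    and "\<not> null_line (join a1 a2)" and "\<not> null_line (join a1 a3)"
  shows "quadrance a1 a3 * quadrance a1 a2 * spread (join a1 a2) (join a1 a3) = quadrea a1 a2 a3"
proof -
  obtain x1 y1 z1 where a1: "a1 = abs_proportion (x1, y1, z1)" "proprel (x1, y1, z1) (x1, y1, z1)"
    by (rule proportion_cases)
  obtain x2 y2 z2 where a2: "a2 = abs_proportion (x2, y2, z2)" "proprel (x2, y2, z2) (x2, y2, z2)"
    by (rule proportion_cases)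
  obtain x3 y3 z3 where a3: "a3 = abs_proportion (x3, y3, z3)" "proprel (x3, y3, z3) (x3, y3, z3)"
    by (rule proportion_cases)
  obtain l m n where L: "cross (x1, y1, z1) (x2, y2, z2) = (l, m, n)"
    by (metis prod_cases3)
  obtain l' m' n' where L': "cross (x1, y1, z1) (x3, y3, z3) = (l', m', n')"
    by (metis prod_cases3)
  have join2: "join a1 a2 = abs_proportion (l, m, n)" "proprel (l, m, n) (l, m, n)"
    using join_abs_proportion proprel_cross a1 a2 assms(2) L by metis+
  have join3: "join a1 a3 = abs_proportion (l', m', n')" "proprel (l', m', n') (l', m', n')"
    using join_abs_proportion proprel_cross a1 a3 assms(3) L' by metis+
  define Q1 Q2 Q3 where Q: "Q1 = x1\<^sup>2 + y1\<^sup>2 - z1\<^sup>2" "Q2 = x2\<^sup>2 + y2\<^sup>2 - z2\<^sup>2" "Q3 = x3\<^sup>2 + y3\<^sup>2 - z3\<^sup>2"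
  define M M' where M: "M = l\<^sup>2 + m\<^sup>2 - n\<^sup>2" "M' = l'\<^sup>2 + m'\<^sup>2 - n'\<^sup>2"
  define D where D: "D = x1 * y2 * z3 - x1 * y3 * z2 + x2 * y3 * z1 - x3 * y2 * z1
    + x3 * y1 * z2 - x2 * y1 * z3"
  have nz: "Q1 \<noteq> 0" "Q2 \<noteq> 0" "Q3 \<noteq> 0" "M \<noteq> 0" "M' \<noteq> 0"
    using assms(5-9) a1 a2 a3 join2 join3
    by (simp_all add: null_point.abs_eq null_line.abs_eq Q M)
  have l: "l = y1 * z2 - z1 * y2" "m = z1 * x2 - x1 * z2" "n = y1 * x2 - x1 * y2"
    using L by (simp_all add: cross_def)
  have l': "l' = y1 * z3 - z1 * y3" "m' = z1 * x3 - x1 * z3" "n' = y1 * x3 - x1 * y3"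
    using L' by (simp_all add: cross_def)
  have lagrange2: "Q1 * Q2 - (x1 * x2 + y1 * y2 - z1 * z2)\<^sup>2 = - M"
    unfolding Q M l by algebra
  have lagrange3: "Q1 * Q3 - (x1 * x3 + y1 * y3 - z1 * z3)\<^sup>2 = - M'"
    unfolding Q M l' by algebra
  have lagrange_join: "M * M' - (l * l' + m * m' - n * n')\<^sup>2 = - (D\<^sup>2 * Q1)"
    unfolding Q M D l l' by algebra
  have "quadrance a1 a2 = - M / (Q1 * Q2)"
    using a1 a2 nz by (simp add: quadrance.abs_eq one_minus_sq_divide lagrange2 flip: Q)
  moreover have "quadrance a1 a3 = - M' / (Q1 * Q3)"
    using a1 a3 nz by (simp add: quadrance.abs_eq one_minus_sq_divide lagrange3 flip: Q)
  moreover have "spread (join a1 a2) (join a1 a3) = - (D\<^sup>2 * Q1) / (M * M')"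
    using join2 join3 nz by (simp add: spread.abs_eq one_minus_sq_divide lagrange_join flip: M)
  moreover have "quadrea a1 a2 a3 = - (D\<^sup>2 / (Q1 * Q2 * Q3))"
    using a1 a2 a3 by (simp add: quadrea.abs_eq flip: Q D)
  \<comment> \<open>\<open>M\<close>, \<open>M'\<close> and one of the two factors \<open>Q1\<close>
    in the denominators cancel; of three minus signs one remains.\<close>
  ultimately show ?thesis
    using nz by (simp only:) (simp add: field_simps)
qed

end
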